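(* Let $G=(V_1,V_2;E)$ be an edge-colored bipartite graph with $|V_1|=n_1$, $|V_2|=n_2$, and let $t\geq s\geq 2$ be integers. If $\sum_{v\in V(G)}d^c(v)>n_1n_2+\sigma_{s,t}\left(n_1n_2^{1-1/s}+n_2n_1^{1-1/s}\right)+s(n_1+n_2)$, where $\sigma_{s,t}=s\left(\frac{t-1}{(s-1)!}\right)^{1/s}$, then $G$ contains a properly colored $K_{s,t}$.
   Context: All graphs are finite and simple. An edge-colored graph is a graph with a color assigned to each edge (not necessarily proper). $d^c(v)$ is the number of distinct colors on edges incident to $v$. A subgraph is properly colored if any two adjacent edges of it receive different colors. *)

theory Defs
  imports Complex_Main
begin

text \<open>Graphs are given by a vertex set and an edge set whose members are two-element vertex
  sets; an edge coloring is a function on edges, of which only the values on the edge set matter.\<close>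

definition bipartite_graph :: "'a set \<Rightarrow> 'a set \<Rightarrow> 'a set set \<Rightarrow> bool" where
  "bipartite_graph V1 V2 E \<longleftrightarrow>
     finite V1 \<and> finite V2 \<and> V1 \<inter> V2 = {} \<and> E \<subseteq> {{u, v} | u v. u \<in> V1 \<and> v \<in> V2}"

definition color_degree :: "'a set set \<Rightarrow> ('a set \<Rightarrow> 'c) \<Rightarrow> 'a \<Rightarrow> nat" where
  "color_degree E c v = card (c ` {e \<in> E. v \<in> e})"

definition properly_colored :: "('a set \<Rightarrow> 'c) \<Rightarrow> 'a set set \<Rightarrow> bool" where
  "properly_colored c F \<longleftrightarrow> (\<forall>e\<in>F. \<forall>f\<in>F. e \<noteq> f \<and> e \<inter> f \<noteq> {} \<longrightarrow> c e \<noteq> c f)"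

definition complete_bipartite :: "nat \<Rightarrow> nat \<Rightarrow> 'a set \<Rightarrow> 'a set set \<Rightarrow> bool" where
  "complete_bipartite s t W F \<longleftrightarrow>
     (\<exists>A B. finite A \<and> finite B \<and> card A = s \<and> card B = t \<and> A \<inter> B = {} \<and>
            W = A \<union> B \<and> F = {{a, b} | a b. a \<in> A \<and> b \<in> B})"

text \<open>In a bipartite host graph this allows either class to contain the \<open>s\<close>-vertex side.\<close>

definition contains_properly_colored_K ::
    "'a set \<Rightarrow> 'a set set \<Rightarrow> ('a set \<Rightarrow> 'c) \<Rightarrow> nat \<Rightarrow> nat \<Rightarrow> bool" where
  "contains_properly_colored_K V E c s t \<longleftrightarrow>
     (\<exists>W F. W \<subseteq> V \<and> F \<subseteq> E \<and> complete_bipartite s t W F \<and> properly_colored c F)"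

definition sigma :: "nat \<Rightarrow> nat \<Rightarrow> real" where
  "sigma s t = real s * ((real t - 1) / fact (s - 1)) powr (1 / real s)"

end

theory Submission
  imports Defs "HOL-Analysis.Convex"
begin

text \<open>At every vertex keep one edge of each color. An edge kept at both of its ends is called
  mutual; the mutual edges form a properly colored subgraph. Each edge is kept at most twice and
  there are at most \<open>n1 * n2\<close> edges, so at least \<open>\<Sum> d\<^sup>c(v) - n1 * n2\<close> edges are mutual. This
  exceeds the Kovari-Sos-Turan bound for \<open>K\<^bsub>s,t\<^esub>\<close>, since
  \<open>sigma s t \<ge> (t - 1) powr (1 / s)\<close> because of \<open>s ^ s \<ge> fact (s - 1)\<close>.\<close>

text \<open>The right-hand side is the falling factorial d (d-1) ... (d-s+1), whose \<open>s\<close>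
  factors are all at least \<open>d + 1 - s\<close>. Truncated subtraction makes the base 0 when
  \<open>d < s\<close>, so vertices of small degree need no separate treatment in later
  sums.\<close>

lemma power_le_fact_mult_binomial: "(d + 1 - s) ^ s \<le> fact s * (d choose s)"
proof (induction s arbitrary: d)
  case (Suc s)
  show ?case
  proof (cases d)
    case (Suc d')
    have "(d + 1 - Suc s) ^ Suc s = (d' + 1 - s) * (d' + 1 - s) ^ s"
      by (simp add: Suc)
    also have "\<dots> \<le> Suc d' * (fact s * (d' choose s))"
      by (intro mult_mono Suc.IH) auto
    also have "\<dots> = fact s * (Suc d' * (d' choose s))"
      by (rule mult.left_commute)
    also have "\<dots> = fact s * (Suc s * (Suc d' choose Suc s))"
      by (simp only: Suc_times_binomial)
    also have "\<dots> = fact (Suc s) * (d choose Suc s)"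
      by (simp add: Suc algebra_simps)
    finally show ?thesis .
  qed simp
qed simp

text \<open>Jensen's inequality for the s-th power with equal weights \<open>1 / n\<close>, cleared
  of denominators by multiplying with \<open>n ^ s\<close>.\<close>

lemma sum_power_le_card_power_mult_sum:
  fixes x :: "'a \<Rightarrow> real"
  assumes "finite Y" and nonneg: "\<And>y. y \<in> Y \<Longrightarrow> 0 \<le> x y" and "0 < s"
  shows "(\<Sum>y\<in>Y. x y) ^ s \<le> real (card Y) ^ (s - 1) * (\<Sum>y\<in>Y. x y ^ s)"
proof (cases "Y = {}")
  case True
  then show ?thesis using \<open>0 < s\<close> by (simp add: zero_power)
next
  case False
  define n where "n = real (card Y)"
  have n: "n > 0" using False \<open>finite Y\<close> by (simp add: n_def card_gt_0_iff)
  \<comment> \<open>Even powers are convex on the whole line, odd ones on the nonnegative half-line,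
    hence the split by parity.\<close>
  have conv: "convex_on {0::real..} (\<lambda>x. x ^ s)"
    using convex_power_odd[of s] convex_power_even[of s] convex_on_subset by blast
  have "(\<Sum>y\<in>Y. (1 / n) *\<^sub>R x y) ^ s \<le> (\<Sum>y\<in>Y. (1 / n) * x y ^ s)"
    using \<open>finite Y\<close> False n nonneg
    by (intro convex_on_sum[OF _ _ conv]) (auto simp: n_def)
  then have "(\<Sum>y\<in>Y. x y) ^ s / n ^ s \<le> (\<Sum>y\<in>Y. x y ^ s) / n"
    by (simp add: sum_divide_distrib[symmetric] power_divide)
  then have "(\<Sum>y\<in>Y. x y) ^ s \<le> (\<Sum>y\<in>Y. x y ^ s) / n * n ^ s"
    using n by (simp add: pos_divide_le_eq)
  also have "\<dots> = n ^ (s - 1) * (\<Sum>y\<in>Y. x y ^ s)"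
    using n \<open>0 < s\<close> by (cases s) (auto simp: field_simps)
  finally show ?thesis by (simp add: n_def)
qed

text \<open>Double counting of the pairs (y, A) where A is an s-subset of
  \<open>N y\<close>.\<close>

lemma sum_card_binomial_eq:
  assumes "finite X" and "finite Y" and N: "\<And>y. y \<in> Y \<Longrightarrow> N y \<subseteq> X"
  shows "(\<Sum>y\<in>Y. card (N y) choose s) = (\<Sum>A | A \<subseteq> X \<and> card A = s. card {y \<in> Y. A \<subseteq> N y})"
proof -
  have fin: "finite {A. A \<subseteq> X \<and> card A = s}" using \<open>finite X\<close> by simp
  have "(\<Sum>y\<in>Y. card (N y) choose s) = (\<Sum>y\<in>Y. card {A \<in> {A. A \<subseteq> X \<and> card A = s}. A \<subseteq> N y})"
  proof (rule sum.cong[OF refl])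
    fix y assume y: "y \<in> Y"
    have "{A \<in> {A. A \<subseteq> X \<and> card A = s}. A \<subseteq> N y} = {A. A \<subseteq> N y \<and> card A = s}"
      using N[OF y] by auto
    moreover have "finite (N y)" using N[OF y] \<open>finite X\<close> finite_subset by blast
    ultimately show "card (N y) choose s = card {A \<in> {A. A \<subseteq> X \<and> card A = s}. A \<subseteq> N y}"
      by (simp add: n_subsets)
  qed
  also have "\<dots> = (\<Sum>A | A \<subseteq> X \<and> card A = s. card {y \<in> Y. A \<subseteq> N y})"
    using fin \<open>finite Y\<close> by (intro sum_multicount_gen) auto
  finally show ?thesis .
qed

text \<open>Without such A and B, every s-subset of \<open>X\<close> lies in at most
  \<open>t - 1\<close> of the sets \<open>N y\<close>. This bounds the number of pairs (y, A) from
  above, while convexity bounds it from below in terms of the number of edges.\<close>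

lemma kovari_sos_turan:
  fixes N :: "'b \<Rightarrow> 'a set"
  assumes "finite X" and "finite Y" and N: "\<And>y. y \<in> Y \<Longrightarrow> N y \<subseteq> X"
    and s: "0 < s" and t: "0 < t"
    and edges: "real (\<Sum>y\<in>Y. card (N y)) >
      (real t - 1) powr (1 / real s) * real (card X) * real (card Y) powr (1 - 1 / real s)
      + (real s - 1) * real (card Y)"
  shows "\<exists>A B. A \<subseteq> X \<and> B \<subseteq> Y \<and> card A = s \<and> card B = t \<and> (\<forall>b\<in>B. A \<subseteq> N b)"
proof (rule ccontr)
  assume none: "\<not> ?thesis"
  have few: "card {y \<in> Y. A \<subseteq> N y} \<le> t - 1" if "A \<subseteq> X" "card A = s" for A
  proof (rule ccontr)
    assume "\<not> ?thesis"
    then have "t \<le> card {y \<in> Y. A \<subseteq> N y}" by simp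
    then obtain B where "B \<subseteq> {y \<in> Y. A \<subseteq> N y}" "card B = t"
      by (meson obtain_subset_with_card_n)
    then show False using none that by blast
  qed
  \<comment> \<open>Even with truncation, \<open>card (N y)\<close> is at most
    \<open>x y + (s - 1)\<close>. This loss, summed over \<open>Y\<close>, is the term
    \<open>(real s - 1) * real (card Y)\<close> of the hypothesis.\<close>
  define x where "x y = card (N y) + 1 - s" for y
  have "(\<Sum>y\<in>Y. x y ^ s) \<le> (\<Sum>y\<in>Y. fact s * (card (N y) choose s))"
    unfolding x_def by (intro sum_mono power_le_fact_mult_binomial)
  also have "\<dots> = fact s * (\<Sum>A | A \<subseteq> X \<and> card A = s. card {y \<in> Y. A \<subseteq> N y})"
    using assms by (simp add: sum_distrib_left[symmetric] sum_card_binomial_eq)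
  also have "\<dots> \<le> fact s * (\<Sum>A | A \<subseteq> X \<and> card A = s. t - 1)"
    by (intro mult_left_mono sum_mono few) auto
  also have "\<dots> = (t - 1) * ((card X choose s) * fact s)"
    using \<open>finite X\<close> by (simp add: n_subsets)
  also have "\<dots> \<le> (t - 1) * card X ^ s"
    by (intro mult_left_mono binomial_fact_pow) auto
  finally have sum_pow: "(\<Sum>y\<in>Y. x y ^ s) \<le> (t - 1) * card X ^ s" .
  \<comment> \<open>\<open>M\<close> is the s-th root of
    \<open>card Y ^ (s - 1) * ((t - 1) * card X ^ s)\<close>, so the chain of estimates below closes
    as \<open>M ^ s < M ^ s\<close>.\<close>
  define M where
    "M = (real t - 1) powr (1 / real s) * real (card X) * real (card Y) powr (1 - 1 / real s)"
  have "M + (real s - 1) * real (card Y) < (\<Sum>y\<in>Y. real (card (N y)))"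
    using edges by (simp add: M_def)
  also have "\<dots> \<le> (\<Sum>y\<in>Y. real (x y) + (real s - 1))"
    using s by (intro sum_mono) (auto simp: x_def)
  finally have "M < (\<Sum>y\<in>Y. real (x y))"
    by (simp add: sum.distrib sum_subtractf algebra_simps)
  moreover have "0 \<le> M" using t by (simp add: M_def)
  ultimately have "M ^ s < (\<Sum>y\<in>Y. real (x y)) ^ s"
    using s by (intro power_strict_mono)
  also have "\<dots> \<le> real (card Y) ^ (s - 1) * (\<Sum>y\<in>Y. real (x y) ^ s)"
    using \<open>finite Y\<close> s by (intro sum_power_le_card_power_mult_sum) auto
  also have "(\<Sum>y\<in>Y. real (x y) ^ s) = real (\<Sum>y\<in>Y. x y ^ s)"
    by simp
  also have "real (card Y) ^ (s - 1) * \<dots> \<le> real (card Y) ^ (s - 1) * real ((t - 1) * card X ^ s)"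
    using sum_pow by (intro mult_left_mono of_nat_mono) auto
  also have "\<dots> = M ^ s"
  proof -
    have "((real t - 1) powr (1 / real s)) ^ s = real t - 1"
      using s t by (simp add: root_powr_inverse[symmetric])
    moreover have "(real (card Y) powr (1 - 1 / real s)) ^ s = real (card Y) ^ (s - 1)"
    proof -
      \<comment> \<open>An empty \<open>Y\<close> would turn \<open>edges\<close> into
        \<open>0 > 0\<close>. Positivity matters for \<open>s = 1\<close>, where
        \<open>0 powr 0 = 0\<close> but \<open>0 ^ 0 = 1\<close>.\<close>
      have "card Y > 0"
        using edges \<open>finite Y\<close> by (auto simp: card_gt_0_iff)
      moreover from this have "(real (card Y) powr (1 - 1 / real s)) ^ s = real (card Y) powr real (s - 1)"
        using s by (simp add: powr_power right_diff_distrib)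
      ultimately show ?thesis by (simp add: powr_realpow)
    qed
    ultimately show ?thesis
      using t by (simp add: M_def power_mult_distrib)
  qed
  finally show False by simp
qed

text \<open>Writing the leading factor \<open>s\<close> of \<open>sigma s t\<close> as the s-th root
  of \<open>s ^ s\<close> puts both sides under one root, which is monotone.\<close>

lemma root_le_sigma:
  assumes "1 \<le> s" and "1 \<le> t"
  shows "(real t - 1) powr (1 / real s) \<le> sigma s t"
proof -
  have "fact (s - 1) \<le> real ((s - 1) ^ (s - 1))"
    using fact_le_power[where ?'a = real and n = "s - 1" ] by simp
  also have "\<dots> \<le> real (s ^ s)"
    using assms by (intro of_nat_mono order_trans[OF power_mono power_increasing]) auto
  finally have "fact (s - 1) \<le> real s ^ s" by simp
  then have "fact (s - 1) * ((real t - 1) / fact (s - 1)) \<le> real s ^ s * ((real t - 1) / fact (s - 1))"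
    using assms by (intro mult_right_mono) auto
  then have "real t - 1 \<le> real s ^ s * ((real t - 1) / fact (s - 1))"
    by simp
  then have "(real t - 1) powr (1 / real s)
      \<le> (real s ^ s * ((real t - 1) / fact (s - 1))) powr (1 / real s)"
    using assms by (intro powr_mono2) auto
  also have "\<dots> = (real s ^ s) powr (1 / real s) * ((real t - 1) / fact (s - 1)) powr (1 / real s)"
    by (rule powr_mult)
  also have "(real s ^ s) powr (1 / real s) = real s"
    using assms by (simp add: powr_realpow[symmetric] powr_powr)
  finally show ?thesis by (simp add: sigma_def)
qed

text \<open>\<open>R v\<close> is a transversal of the color classes at \<open>v\<close>. The
  choices at different vertices are independent, so an edge may be kept at one end only.\<close>

lemma color_representatives:
  obtains R where "\<And>v. R v \<subseteq> {e \<in> E. v \<in> e}" "\<And>v. inj_on c (R v)"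
    "\<And>v. card (R v) = color_degree E c v"
proof -
  have "\<exists>U. U \<subseteq> {e \<in> E. v \<in> e} \<and> inj_on c U \<and> c ` {e \<in> E. v \<in> e} = c ` U" for v
    using subset_image_inj[of "c ` {e \<in> E. v \<in> e}" c "{e \<in> E. v \<in> e}"] by simp
  then obtain R where R: "R v \<subseteq> {e \<in> E. v \<in> e}" "inj_on c (R v)" 
    "c ` {e \<in> E. v \<in> e} = c ` R v" for v by metis
  then have "card (R v) = color_degree E c v" for v
    unfolding color_degree_def by (simp add: card_image)
  then show ?thesis using R that by blast
qed

text \<open>Inclusion-exclusion for the edges kept at their \<open>V1\<close> end and those kept at
  their \<open>V2\<close> end; the intersection consists of the mutual edges.\<close>

lemma sum_card_representatives_le:
  assumes "bipartite_graph V1 V2 E" and "\<And>v. R v \<subseteq> {e \<in> E. v \<in> e}"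
  shows "(\<Sum>v\<in>V1 \<union> V2. card (R v))
    \<le> card V1 * card V2 + (\<Sum>y\<in>V2. card {x \<in> V1. {x, y} \<in> R x \<inter> R y})"
proof -
  have fin: "finite V1" "finite V2" and disj: "V1 \<inter> V2 = {}"
    and E: "E \<subseteq> {{u, v} | u v. u \<in> V1 \<and> v \<in> V2}"
    using assms(1) by (auto simp: bipartite_graph_def)
  let ?P1 = "SIGMA x:V1. {y \<in> V2. {x, y} \<in> R x}"
  \<comment> \<open>The swap orients these pairs like those of \<open>?P1\<close>, so that both sets
    lie in \<open>V1 \<times> V2\<close> and their union has at most
    \<open>card V1 * card V2\<close> elements.\<close>
  let ?P2 = "prod.swap ` (SIGMA y:V2. {x \<in> V1. {x, y} \<in> R y})"
  have le1: "card (R x) \<le> card {y \<in> V2. {x, y} \<in> R x}" if "x \<in> V1" for x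
  proof (rule surj_card_le)
    show "R x \<subseteq> (\<lambda>y. {x, y}) ` {y \<in> V2. {x, y} \<in> R x}"
    proof
      fix e assume e: "e \<in> R x"
      \<comment> \<open>A kept edge contains \<open>x\<close>, and disjointness of the classes
        forces \<open>x\<close> to be its end in \<open>V1\<close>; the other end names the
        pair.\<close>
      with assms(2) E obtain u v where uv: "e = {u, v}" "u \<in> V1" "v \<in> V2" "x \<in> e" by blast
      with that disj have "u = x" by auto
      with uv e show "e \<in> (\<lambda>y. {x, y}) ` {y \<in> V2. {x, y} \<in> R x}" by auto
    qed
  qed (use fin in simp)
  have le2: "card (R y) \<le> card {x \<in> V1. {x, y} \<in> R y}" if "y \<in> V2" for y
  proof (rule surj_card_le)
    show "R y \<subseteq> (\<lambda>x. {x, y}) ` {x \<in> V1. {x, y} \<in> R y}"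
    proof
      fix e assume e: "e \<in> R y"
      with assms(2) E obtain u v where uv: "e = {u, v}" "u \<in> V1" "v \<in> V2" "y \<in> e" by blast
      with that disj have "v = y" by auto
      with uv e show "e \<in> (\<lambda>x. {x, y}) ` {x \<in> V1. {x, y} \<in> R y}" by auto
    qed
  qed (use fin in simp)
  have "(\<Sum>v\<in>V1 \<union> V2. card (R v)) = (\<Sum>x\<in>V1. card (R x)) + (\<Sum>y\<in>V2. card (R y))"
    using fin disj by (rule sum.union_disjoint)
  also have "\<dots> \<le> (\<Sum>x\<in>V1. card {y \<in> V2. {x, y} \<in> R x}) + (\<Sum>y\<in>V2. card {x \<in> V1. {x, y} \<in> R y})"
    by (intro add_mono sum_mono le1 le2)
  also have "\<dots> = card ?P1 + card ?P2"
    using fin by (simp add: card_image)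
  also have "\<dots> = card (?P1 \<union> ?P2) + card (?P1 \<inter> ?P2)"
    using fin by (intro card_Un_Int) auto
  also have "\<dots> \<le> card (V1 \<times> V2) + card (SIGMA y:V2. {x \<in> V1. {x, y} \<in> R x \<inter> R y})"
  proof (rule add_mono)
    show "card (?P1 \<union> ?P2) \<le> card (V1 \<times> V2)"
      using fin by (intro card_mono) auto
    have "?P1 \<inter> ?P2 \<subseteq> prod.swap ` (SIGMA y:V2. {x \<in> V1. {x, y} \<in> R x \<inter> R y})"
      by force
    then show "card (?P1 \<inter> ?P2) \<le> card (SIGMA y:V2. {x \<in> V1. {x, y} \<in> R x \<inter> R y})"
      using fin by (intro surj_card_le) auto
  qed
  also have "\<dots> = card V1 * card V2 + (\<Sum>y\<in>V2. card {x \<in> V1. {x, y} \<in> R x \<inter> R y})"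
    using fin by simp
  finally show ?thesis .
qed

theorem theorem4p3:
  fixes V1 V2 :: "'a set" and E :: "'a set set" and c :: "'a set \<Rightarrow> 'c"
    and n1 n2 s t :: nat
  assumes "bipartite_graph V1 V2 E"
    and "card V1 = n1" and "card V2 = n2"
    and "2 \<le> s" and "s \<le> t"
    and "real (\<Sum>v\<in>V1 \<union> V2. color_degree E c v) >
           real n1 * real n2
           + sigma s t * (real n1 * real n2 powr (1 - 1 / real s)
                          + real n2 * real n1 powr (1 - 1 / real s))
           + real s * (real n1 + real n2)"
  shows "contains_properly_colored_K (V1 \<union> V2) E c s t"
proof -
  have fin: "finite V1" "finite V2" and disj: "V1 \<inter> V2 = {}"
    using assms(1) by (auto simp: bipartite_graph_def)
  obtain R where R: "\<And>v. R v \<subseteq> {e \<in> E. v \<in> e}" and inj: "\<And>v. inj_on c (R v)"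
    and card_R: "\<And>v. card (R v) = color_degree E c v"
    by (rule color_representatives[of E c]) blast
  \<comment> \<open>\<open>N y\<close> is the neighborhood of \<open>y\<close> in the graph of
    mutual edges.\<close>
  define N where "N y = {x \<in> V1. {x, y} \<in> R x \<inter> R y}" for y
  have "(\<Sum>v\<in>V1 \<union> V2. color_degree E c v) \<le> n1 * n2 + (\<Sum>y\<in>V2. card (N y))"
    using sum_card_representatives_le[OF assms(1), of R] R assms(2,3)
    by (simp add: card_R N_def)
  then have many: "real (\<Sum>v\<in>V1 \<union> V2. color_degree E c v)
      \<le> real n1 * real n2 + real (\<Sum>y\<in>V2. card (N y))"
    by (metis of_nat_add of_nat_le_iff of_nat_mult)
  \<comment> \<open>This is the main term for the orientation with the s-side in \<open>V1\<close>
    and the t-side in \<open>V2\<close>.\<close>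
  have root: "(real t - 1) powr (1 / real s) * (real n1 * real n2 powr (1 - 1 / real s))
      \<le> sigma s t * (real n1 * real n2 powr (1 - 1 / real s))"
    using assms(4,5) by (intro mult_right_mono root_le_sigma) auto
  have "0 \<le> sigma s t * (real n2 * real n1 powr (1 - 1 / real s))"
    by (simp add: sigma_def)
  moreover have "0 \<le> real s * real n1" "(real s - 1) * real n2 \<le> real s * real n2"
    by (auto intro: mult_right_mono)
  ultimately have edges: "real (\<Sum>y\<in>V2. card (N y)) >
      (real t - 1) powr (1 / real s) * real (card V1) * real (card V2) powr (1 - 1 / real s)
      + (real s - 1) * real (card V2)"
    using many root assms(6) unfolding assms(2,3) distrib_left mult.assoc by linarith
  have "N y \<subseteq> V1" for y by (auto simp: N_def)
  then obtain A B where A: "A \<subseteq> V1" "card A = s" and B: "B \<subseteq> V2" "card B = t"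
    and AB: "\<forall>b\<in>B. A \<subseteq> N b"
    using kovari_sos_turan[of V1 V2 N s t] edges fin assms(4,5) by auto
  define F where "F = {{a, b} | a b. a \<in> A \<and> b \<in> B}"
  \<comment> \<open>Since \<open>a\<close> lies in \<open>N b\<close>, the edge
    \<open>{a, b}\<close> is kept at both ends. Two edges of \<open>F\<close> meeting at
    \<open>v\<close> are thus both in \<open>R v\<close>, where \<open>c\<close> is
    injective.\<close>
  have F_R: "e \<in> R v" if "e \<in> F" "v \<in> e" for e v
    using that AB by (auto simp: F_def N_def)
  have "F \<subseteq> E"
  proof
    fix e assume "e \<in> F"
    moreover from this obtain a where "a \<in> e" by (auto simp: F_def)
    ultimately show "e \<in> E" using F_R R by blast
  qed
  moreover have "properly_colored c F"
    unfolding properly_colored_def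
  proof (intro ballI impI)
    fix e f assume ef: "e \<in> F" "f \<in> F" "e \<noteq> f \<and> e \<inter> f \<noteq> {}"
    then obtain v where "v \<in> e" "v \<in> f" by blast
    with ef have "e \<in> R v" "f \<in> R v" by (auto intro: F_R)
    with ef show "c e \<noteq> c f" using inj_onD[OF inj] by blast
  qed
  moreover have "complete_bipartite s t (A \<union> B) F"
  proof -
    have "finite A" "finite B" using A B fin finite_subset by auto
    moreover have "A \<inter> B = {}" using A B disj by blast
    ultimately show ?thesis
      unfolding complete_bipartite_def F_def
      by (intro exI[of _ A] exI[of _ B] conjI refl A(2) B(2))
  qed
  ultimately show ?thesis
    unfolding contains_properly_colored_K_def
    by (intro exI[of _ "A \<union> B"] exI[of _ F] conjI Un_mono A(1) B(1))
qed

end
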